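(* The discrete dynamical systems $(Q,\ell,\sigma)$ and $([0,1],d^*,f)$ are topologically conjugate, where $f$ is the dyadic map, $Q$ is the set of its $L$-$R$ symbol sequences with metric $\ell$ and shift map $\sigma$, and $d^*$ is the metric on $[0,1]$ transported from $\ell$ (all defined in the context).
   Context: The dyadic map $f:[0,1]\to[0,1]$ is $f(x)=2x$ if $0\le x<\frac12$ and $f(x)=2x-1$ if $\frac12\le x\le 1$. $Q$ is the set of all infinite one-sided sequences over the alphabet $\{L,R\}$ that do not end in an infinite string of $R$'s, together with the single sequence $RRRR\dots$. (This is the set of itineraries of points of $[0,1]$ under $f$, where the $n$th symbol is $L$ if $f^{n-1}(x)\in[0,\frac12)$ and $R$ if $f^{n-1}(x)\in[\frac12,1]$.) The shift map $\sigma:Q\to Q$ deletes the first symbol. The metric $\ell$ on $Q$ is $\ell(x,y)=2^{-k}$ if $x\ne y$, where $k$ is the length of the longest prefix shared by $x$ and $y$, and $\ell(x,x)=0$. The bijection $h:Q\to[0,1]$ is given by $h(s_1s_2s_3\dots)=\sum_{i\ge1} b_i2^{-i}$ with $b_i=0$ if $s_i=L$ and $b_i=1$ if $s_i=R$. The metric $d^*$ on $[0,1]$ is $d^*(x,y)=\ell(h^{-1}(x),h^{-1}(y))$. Two discrete dynamical systems $(X_1,d_1,f_1)$ and $(X_2,d_2,f_2)$ (sets with metrics $d_i$ and functions $f_i:X_i\to X_i$) are topologically conjugate if and only if there exists a homeomorphism $g:X_1\to X_2$ (for the metric topologies) with $g\circ f_1=f_2\circ g$. *)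

theory Defs
  imports "HOL-Analysis.Abstract_Metric_Spaces"
begin

text \<open>Symbol sequences \<open>s\<^sub>1 s\<^sub>2 s\<^sub>3 \<dots>\<close> are functions on \<^typ>\<open>nat\<close>, indexed from \<open>0\<close>:
  the symbol \<open>s\<^sub>i\<close> of the mathematical text is \<open>s (i - 1)\<close>.\<close>

datatype symbol = L | R

definition dyadic_map :: "real \<Rightarrow> real" where
  "dyadic_map x = (if x < 1/2 then 2 * x else 2 * x - 1)"

definition ends_in_Rs :: "(nat \<Rightarrow> symbol) \<Rightarrow> bool" where
  "ends_in_Rs s \<longleftrightarrow> (\<exists>N. \<forall>n\<ge>N. s n = R)"

definition Q :: "(nat \<Rightarrow> symbol) set" where
  "Q = {s. \<not> ends_in_Rs s} \<union> {\<lambda>_. R}"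

definition shift :: "(nat \<Rightarrow> symbol) \<Rightarrow> (nat \<Rightarrow> symbol)" where
  "shift s = (\<lambda>n. s (Suc n))"

definition common_prefix_length :: "(nat \<Rightarrow> symbol) \<Rightarrow> (nat \<Rightarrow> symbol) \<Rightarrow> nat" where
  "common_prefix_length s t = (GREATEST k. \<forall>i<k. s i = t i)"

definition ell :: "(nat \<Rightarrow> symbol) \<Rightarrow> (nat \<Rightarrow> symbol) \<Rightarrow> real" where
  "ell s t = (if s = t then 0 else (1/2) ^ common_prefix_length s t)"

primrec bit_of :: "symbol \<Rightarrow> real" where
  "bit_of L = 0"
| "bit_of R = 1"

definition h :: "(nat \<Rightarrow> symbol) \<Rightarrow> real" where
  "h s = (\<Sum>n. bit_of (s n) * (1/2) ^ Suc n)"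

definition dstar :: "real \<Rightarrow> real \<Rightarrow> real" where
  "dstar x y = ell (inv_into Q h x) (inv_into Q h y)"

definition discrete_dynamical_system ::
    "'a set \<Rightarrow> ('a \<Rightarrow> 'a \<Rightarrow> real) \<Rightarrow> ('a \<Rightarrow> 'a) \<Rightarrow> bool" where
  "discrete_dynamical_system X d f \<longleftrightarrow> Metric_space X d \<and> f ` X \<subseteq> X"

text \<open>The constant \<^const>\<open>Metric_space.mtopology\<close> is meaningful only for a genuine metric, so
  conjugacy includes the requirement that both triples are dynamical systems.\<close>

definition topologically_conjugate ::
    "'a set \<Rightarrow> ('a \<Rightarrow> 'a \<Rightarrow> real) \<Rightarrow> ('a \<Rightarrow> 'a) \<Rightarrow>
     'b set \<Rightarrow> ('b \<Rightarrow> 'b \<Rightarrow> real) \<Rightarrow> ('b \<Rightarrow> 'b) \<Rightarrow> bool" where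
  "topologically_conjugate X1 d1 f1 X2 d2 f2 \<longleftrightarrow>
     discrete_dynamical_system X1 d1 f1 \<and> discrete_dynamical_system X2 d2 f2 \<and>
     (\<exists>g. homeomorphic_map (Metric_space.mtopology X1 d1) (Metric_space.mtopology X2 d2) g \<and>
          (\<forall>x\<in>X1. g (f1 x) = f2 (g x)))"

end

(* The map h conjugates the shift to the dyadic map because h s = (b_0 + h (shift s)) / 2
   and h (shift s) < 1 whenever s is in Q and starts with L.  The itinerary map, which records
   on which side of 1/2 the iterates of the dyadic map lie, is a two-sided inverse of h; so h is
   a bijection, and by definition of the transported metric it is an isometry. *)

theory Submission
  imports Defs
begin

lemma ell_commute: "ell s t = ell t s"
  by (simp add: ell_def common_prefix_length_def eq_commute)

lemma ell_nonneg: "0 \<le> ell s t"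
  by (simp add: ell_def)

lemma ell_eq_0_iff: "ell s t = 0 \<longleftrightarrow> s = t"
  by (simp add: ell_def)

lemma le_common_prefix_length_iff:
  assumes "s \<noteq> t"
  shows "k \<le> common_prefix_length s t \<longleftrightarrow> (\<forall>i<k. s i = t i)"
proof -
  obtain m where m: "s m \<noteq> t m"
    using assms by blast
  have bound: "k \<le> m" if "\<forall>i<k. s i = t i" for k
    using m that by (meson not_le)
  have "\<forall>i<common_prefix_length s t. s i = t i"
    unfolding common_prefix_length_def
    \<comment> \<open>The witness \<open>k = 0\<close> holds vacuously, and the disagreement at
      \<open>m\<close> bounds all candidates, so the \<open>GREATEST\<close> is attained.\<close>
    by (rule GreatestI_nat[where k = 0 and b = m]) (use bound in auto)
  moreover have "k \<le> common_prefix_length s t" if "\<forall>i<k. s i = t i"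
    unfolding common_prefix_length_def
    by (rule Greatest_le_nat[where b = m]) (use bound that in auto)
  ultimately show ?thesis
    by (meson less_le_trans)
qed

text \<open>Closed balls of dyadic radius are cylinder sets. This form also covers
  \<open>s = t\<close>, where both sides are true.\<close>

lemma ell_le_power_iff: "ell s t \<le> (1/2) ^ k \<longleftrightarrow> (\<forall>i<k. s i = t i)"
  by (cases "s = t") (simp_all add: ell_def le_common_prefix_length_iff[symmetric])

text \<open>Agreement of \<open>s\<close>, \<open>t\<close> on \<open>m\<close> symbols and of
  \<open>t\<close>, \<open>u\<close> on \<open>n\<close> symbols gives agreement of
  \<open>s\<close>, \<open>u\<close> on \<open>min m n\<close> symbols.\<close>

lemma ell_ultrametric: "ell s u \<le> max (ell s t) (ell t u)"
proof (cases "s = t \<or> t = u")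
  case True
  then show ?thesis
    by (auto simp: ell_eq_0_iff ell_nonneg)
next
  case False
  define m where "m = common_prefix_length s t"
  define n where "n = common_prefix_length t u"
  have st: "ell s t = (1/2) ^ m" and tu: "ell t u = (1/2) ^ n"
    using False by (auto simp: ell_def m_def n_def)
  have "\<forall>i<m. s i = t i" "\<forall>i<n. t i = u i"
    using ell_le_power_iff st tu by (metis order_refl)+
  then have "ell s u \<le> (1/2) ^ min m n"
    unfolding ell_le_power_iff by simp
  also have "\<dots> \<le> max (ell s t) (ell t u)"
    by (simp add: st tu min_def)
  finally show ?thesis .
qed

text \<open>The carrier is arbitrary so that both \<open>Q\<close> and \<open>UNIV\<close> can be
  used later.\<close>

lemma Metric_space_ell: "Metric_space S ell"
proof
  show "ell s u \<le> ell s t + ell t u" for s t u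
    using ell_ultrametric[of s u t] ell_nonneg[of s t] ell_nonneg[of t u] by linarith
qed (auto simp: ell_nonneg ell_eq_0_iff ell_commute)

lemma shift_in_Q: "s \<in> Q \<Longrightarrow> shift s \<in> Q"
  unfolding Q_def ends_in_Rs_def shift_def
  by auto (metis Suc_le_D Suc_le_mono)

text \<open>Otherwise \<open>s\<close> would be LRRR..., the second binary expansion of 1/2, which
  \<open>Q\<close> excludes.\<close>

lemma shift_ne_all_R:
  assumes "s \<in> Q" "s 0 = L"
  shows "shift s \<noteq> (\<lambda>_. R)"
proof
  assume "shift s = (\<lambda>_. R)"
  then have "s (Suc n) = R" for n
    by (metis shift_def)
  then have "ends_in_Rs s"
    unfolding ends_in_Rs_def by (metis Suc_le_D One_nat_def)
  with assms show False
    by (auto simp: Q_def)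
qed

lemma bit_of_bounds: "0 \<le> bit_of c" "bit_of c \<le> 1"
  by (cases c; simp)+

lemma summable_bits: "summable (\<lambda>n. bit_of (s n) * (1/2) ^ Suc n)"
  by (rule summable_comparison_test'[OF sums_summable[OF power_half_series], of 0])
     (simp add: abs_mult bit_of_bounds)

lemma h_shift: "h s = (bit_of (s 0) + h (shift s)) / 2"
proof -
  have "h s = bit_of (s 0) / 2 + (\<Sum>n. bit_of (s (Suc n)) * (1/2) ^ Suc (Suc n))"
    unfolding h_def using suminf_split_head[OF summable_bits[of s]] by simp
  also have "(\<Sum>n. bit_of (s (Suc n)) * (1/2) ^ Suc (Suc n)) = h (shift s) / 2"
    unfolding h_def shift_def
    using suminf_divide[OF summable_bits[of "\<lambda>n. s (Suc n)"], of 2] by simp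
  finally show ?thesis
    by (simp add: add_divide_distrib)
qed

lemma h_nonneg: "0 \<le> h s"
  unfolding h_def by (rule suminf_nonneg[OF summable_bits]) (simp add: bit_of_bounds)

text \<open>Subtracting from the geometric series with sum 1 turns upper bounds on \<open>h\<close>
  into sign statements about a series with nonnegative terms.\<close>

lemma one_minus_h_sums: "(\<lambda>n. (1 - bit_of (s n)) * (1/2) ^ Suc n) sums (1 - h s)"
  using sums_diff[OF power_half_series summable_sums[OF summable_bits[of s]]]
  by (simp add: h_def left_diff_distrib del: power_Suc)

lemma h_le_1: "h s \<le> 1"
  using sums_le[OF _ sums_zero one_minus_h_sums[of s]] by (simp add: bit_of_bounds)

lemma h_less_1:
  assumes "s \<noteq> (\<lambda>_. R)"
  shows "h s < 1"
proof -
  obtain n where "s n = L"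
    using assms symbol.exhaust by blast
  \<comment> \<open>A single symbol \<open>L\<close> already contributes a positive term.\<close>
  then have "0 < (\<Sum>n. (1 - bit_of (s n)) * (1/2) ^ Suc n)"
    by (intro suminf_pos2[of _ n] sums_summable[OF one_minus_h_sums]) (simp_all add: bit_of_bounds)
  then show ?thesis
    by (simp add: sums_unique[OF one_minus_h_sums, symmetric] del: power_Suc)
qed

lemma h_less_half_iff:
  assumes "s \<in> Q"
  shows "h s < 1/2 \<longleftrightarrow> s 0 = L"
  using h_less_1[OF shift_ne_all_R[OF assms]] h_nonneg[of "shift s"] h_shift[of s]
  by (cases "s 0") auto

lemma h_conjugates_shift:
  assumes "s \<in> Q"
  shows "h (shift s) = dyadic_map (h s)"
  using h_less_half_iff[OF assms] h_shift[of s]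
  by (cases "s 0") (auto simp: dyadic_map_def)

lemma h_funpow_shift:
  assumes "s \<in> Q"
  shows "(shift ^^ n) s \<in> Q" "h ((shift ^^ n) s) = (dyadic_map ^^ n) (h s)"
  by (induction n) (simp_all add: assms shift_in_Q h_conjugates_shift)

lemma funpow_shift: "(shift ^^ n) s i = s (n + i)"
  by (induction n arbitrary: i) (simp_all add: shift_def)

definition itinerary :: "real \<Rightarrow> nat \<Rightarrow> symbol" where
  "itinerary x n = (if (dyadic_map ^^ n) x < 1/2 then L else R)"

text \<open>The \<open>n\<close>th iterate of \<open>h s\<close> is \<open>h\<close> of the
  \<open>n\<close>-fold shift, and its side of 1/2 reveals the first symbol there, namely
  \<open>s n\<close>.\<close>

lemma itinerary_h:
  assumes "s \<in> Q"
  shows "itinerary (h s) = s"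
proof
  fix n
  show "itinerary (h s) n = s n"
    using h_less_half_iff[OF h_funpow_shift(1)[OF assms, of n]]
    by (cases "s n") (simp_all add: itinerary_def h_funpow_shift(2)[OF assms] funpow_shift)
qed

lemma dyadic_map_in_unit: "x \<in> {0..1} \<Longrightarrow> dyadic_map x \<in> {0..1}"
  by (auto simp: dyadic_map_def)

lemma funpow_dyadic_map_in_unit: "x \<in> {0..1} \<Longrightarrow> (dyadic_map ^^ n) x \<in> {0..1}"
  by (induction n) (simp_all only: funpow.simps o_apply id_apply dyadic_map_in_unit)

text \<open>The left branch stays below 1, and the right branch reaches 1 only at its endpoint.
  Hence an orbit can arrive at 1 only by starting there.\<close>

lemma dyadic_map_eq_1_iff: "x \<in> {0..1} \<Longrightarrow> dyadic_map x = 1 \<longleftrightarrow> x = 1"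
  by (auto simp: dyadic_map_def)

lemma funpow_dyadic_map_eq_1_iff: "x \<in> {0..1} \<Longrightarrow> (dyadic_map ^^ n) x = 1 \<longleftrightarrow> x = 1"
  by (induction n) (auto simp: dyadic_map_eq_1_iff[OF funpow_dyadic_map_in_unit])

text \<open>The sum telescopes: each bit is twice the current iterate minus the next one.\<close>

lemma partial_sum_itinerary:
  "(\<Sum>i<n. bit_of (itinerary x i) * (1/2) ^ Suc i) = x - (dyadic_map ^^ n) x * (1/2) ^ n"
proof (induction n)
  case (Suc n)
  have bit: "bit_of (itinerary x n) = 2 * (dyadic_map ^^ n) x - (dyadic_map ^^ Suc n) x"
    by (simp add: itinerary_def dyadic_map_def)
  show ?case
    unfolding sum.lessThan_Suc Suc bit by (simp add: field_simps)
qed simp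

lemma h_itinerary:
  assumes "x \<in> {0..1}"
  shows "h (itinerary x) = x"
proof -
  have "(\<lambda>n. (dyadic_map ^^ n) x * (1/2) ^ n) \<longlonglongrightarrow> 0"
  proof (rule Lim_null_comparison)
    \<comment> \<open>The orbit stays in the unit interval, so the remainder of the telescoped sum
      is at most \<open>(1/2) ^ n\<close>.\<close>
    show "\<forall>\<^sub>F n in sequentially. norm ((dyadic_map ^^ n) x * (1/2) ^ n) \<le> (1/2) ^ n"
      using funpow_dyadic_map_in_unit[OF assms] by (simp add: abs_mult)
    show "(\<lambda>n. (1/2::real) ^ n) \<longlonglongrightarrow> 0"
      by (rule LIMSEQ_power_zero) simp
  qed
  then have "(\<lambda>n. bit_of (itinerary x n) * (1/2) ^ Suc n) sums x"
    unfolding sums_def partial_sum_itinerary using tendsto_diff[OF tendsto_const] by fastforce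
  then show ?thesis
    by (simp add: h_def sums_unique[symmetric])
qed

lemma itinerary_funpow: "itinerary ((dyadic_map ^^ n) x) = (shift ^^ n) (itinerary x)"
  by (rule ext) (simp add: itinerary_def funpow_shift funpow_add add.commute[of n])

lemma h_all_R: "h (\<lambda>_. R) = 1"
  using power_half_series by (simp add: h_def sums_unique[symmetric])

lemma itinerary_in_Q:
  assumes x: "x \<in> {0..1}"
  shows "itinerary x \<in> Q"
proof (cases "ends_in_Rs (itinerary x)")
  case True
  then obtain N where "\<And>n. N \<le> n \<Longrightarrow> itinerary x n = R"
    by (auto simp: ends_in_Rs_def)
  then have "itinerary ((dyadic_map ^^ N) x) = (\<lambda>_. R)"
    by (auto simp: itinerary_funpow funpow_shift)
  then have "(dyadic_map ^^ N) x = 1"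
    using h_itinerary[OF funpow_dyadic_map_in_unit[OF x]] h_all_R by metis
  then have "x = 1"
    using funpow_dyadic_map_eq_1_iff[OF x] by blast
  then have "itinerary x = (\<lambda>_. R)"
    using itinerary_h[of "\<lambda>_. R"] by (simp add: Q_def h_all_R)
  then show ?thesis
    by (simp add: Q_def)
qed (simp add: Q_def)

lemma inj_on_h: "inj_on h Q"
  by (metis inj_onI itinerary_h)

lemma h_image_Q: "h ` Q = {0..1}"
proof
  show "h ` Q \<subseteq> {0..1}"
    by (auto simp: h_nonneg h_le_1)
  show "{0..1} \<subseteq> h ` Q"
    using h_itinerary itinerary_in_Q by (metis image_eqI subsetI)
qed

lemma dstar_h: "s \<in> Q \<Longrightarrow> t \<in> Q \<Longrightarrow> dstar (h s) (h t) = ell s t"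
  by (simp add: dstar_def inj_on_h)

lemma Metric_space_dstar: "Metric_space {0..1} dstar"
proof -
  \<comment> \<open>With carrier \<open>UNIV\<close>, the triangle inequality applies to values of
    \<open>inv_into Q h\<close> without checking that they lie in \<open>Q\<close>.\<close>
  interpret Metric_space UNIV ell
    by (rule Metric_space_ell)
  show ?thesis
  proof
    show "dstar x y = 0 \<longleftrightarrow> x = y" if "x \<in> {0..1}" "y \<in> {0..1}" for x y
      \<comment> \<open>Distance zero means equal preimages, and \<open>inv_into\<close> is
        injective on the image of \<open>h\<close>, which is the unit interval.\<close>
      using that inv_into_injective[of Q h x y] by (auto simp: dstar_def h_image_Q)
    show "dstar x z \<le> dstar x y + dstar y z" for x y z
      by (simp add: dstar_def triangle)
  qed (simp_all add: dstar_def commute)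
qed

theorem mainTheorem5:
  shows "topologically_conjugate Q ell shift {0..1::real} dstar dyadic_map"
proof -
  interpret Metric_space12 Q ell "{0..1}" dstar
    by (simp add: Metric_space12_def Metric_space_ell Metric_space_dstar)
  have "homeomorphic_map M1.mtopology M2.mtopology h"
    \<comment> \<open>A surjective isometry is a homeomorphism, so no separate continuity argument
      is needed for \<open>h\<close> or its inverse.\<close>
    by (rule isometry_imp_homeomorphic_map) (simp_all add: h_image_Q dstar_h)
  then show ?thesis
    unfolding topologically_conjugate_def discrete_dynamical_system_def
    using Metric_space_ell Metric_space_dstar shift_in_Q dyadic_map_in_unit h_conjugates_shift
    by blast
qed

end
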